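(* Let $G$ be a finite simple graph. Then $\operatorname{reg}(I(G)^{[2]})\leq 2+\nu(G)$ (with the convention $\operatorname{reg}((0))=1$).
   Context: $G$ is a finite simple graph on vertex set $\{x_1,\ldots,x_n\}$ identified with the variables of $S=K[x_1,\ldots,x_n]$ ($K$ a field); edges are identified with degree-2 monomials. $I(G)$ is the edge ideal of $G$, and $I(G)^{[2]}$ is the ideal generated by all products $e_1e_2$ of two disjoint edges of $G$ (the second squarefree power). $\nu(G)$ is the matching number of $G$. For a graded ideal $I\neq0$, $\operatorname{reg}(I)=\max\{j-i: \dim_K\operatorname{Tor}_i^S(I,K)_j\neq0\}$; by convention $\operatorname{reg}((0))=1$. *)

theory Defs
  imports Main "HOL-Library.Poly_Mapping"
begin

text \<open>Polynomial ring S = K[x_v : v in 'v] over a field K ('k), for a finite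
  (linearly ordered) vertex type 'v. Monomials are 'v =>0 nat (exponent vectors).\<close>

type_synonym ('v, 'k) mpoly = "('v \<Rightarrow>\<^sub>0 nat) \<Rightarrow>\<^sub>0 'k"

definition var :: "'v \<Rightarrow> ('v, 'k::comm_ring_1) mpoly" where
  "var v = Poly_Mapping.single (Poly_Mapping.single v 1) 1"

definition mdeg :: "('v::finite \<Rightarrow>\<^sub>0 nat) \<Rightarrow> nat" where
  "mdeg m = (\<Sum>v\<in>UNIV. Poly_Mapping.lookup m v)"

text \<open>Homogeneous of (integer) degree d; the zero polynomial is homogeneous of every degree.\<close>
definition homogeneous :: "int \<Rightarrow> ('v::finite, 'k::comm_ring_1) mpoly \<Rightarrow> bool" where
  "homogeneous d p \<longleftrightarrow> (\<forall>m\<in>Poly_Mapping.keys p. int (mdeg m) = d)"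

definition gen_ideal :: "('v, 'k::comm_ring_1) mpoly set \<Rightarrow> ('v, 'k) mpoly set" where
  "gen_ideal A = {\<Sum>a\<in>T. r a * a | T r. finite T \<and> T \<subseteq> A}"

text \<open>Simple graph on vertex set UNIV :: 'v set, edges are 2-element sets.\<close>
definition simple_graph :: "'v set set \<Rightarrow> bool" where
  "simple_graph E \<longleftrightarrow> (\<forall>e\<in>E. card e = 2)"

definition edge_mon :: "'v set \<Rightarrow> ('v, 'k::comm_ring_1) mpoly" where
  "edge_mon e = (\<Prod>v\<in>e. var v)"

definition edge_ideal :: "'v set set \<Rightarrow> ('v, 'k::comm_ring_1) mpoly set" where
  "edge_ideal E = gen_ideal (edge_mon ` E)"

definition sqfree_power2 :: "'v set set \<Rightarrow> ('v, 'k::comm_ring_1) mpoly set" where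
  "sqfree_power2 E = gen_ideal {edge_mon e1 * edge_mon e2 | e1 e2. e1 \<in> E \<and> e2 \<in> E \<and> e1 \<inter> e2 = {}}"

definition matching :: "'v set set \<Rightarrow> 'v set set \<Rightarrow> bool" where
  "matching E M \<longleftrightarrow> M \<subseteq> E \<and> (\<forall>e1\<in>M. \<forall>e2\<in>M. e1 \<noteq> e2 \<longrightarrow> e1 \<inter> e2 = {})"

definition matching_number :: "'v set set \<Rightarrow> nat" where
  "matching_number E = Max (card ` {M. matching E M})"

text \<open>Tor via the Koszul resolution K(x) of K = S/(x_v) (a free resolution of K, so
  Tor_i^S(I,K) = H_i(I \<otimes>_S K(x))). The module I \<otimes>_S K(x)_i is identified with
  I^(binomial n i): a chain is a function c from subsets F of the vertex set to I,
  supported on |F| = i (basis element e_F of degree |F|).  The differential is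
  d(f e_F) = \<Sum>_{k\<in>F} (-1)^{#{l\<in>F. l<k}} x_k f e_{F-{k}}.\<close>

definition koszul_sign :: "'v::linorder \<Rightarrow> 'v set \<Rightarrow> 'k::comm_ring_1" where
  "koszul_sign k F = (-1) ^ card {l\<in>F. l < k}"

definition koszul_d :: "('v::{finite,linorder} set \<Rightarrow> ('v, 'k::comm_ring_1) mpoly)
                         \<Rightarrow> ('v set \<Rightarrow> ('v, 'k) mpoly)" where
  "koszul_d c = (\<lambda>G. \<Sum>k\<in>UNIV - G.
      Poly_Mapping.single 0 (koszul_sign k (insert k G)) * var k * c (insert k G))"

text \<open>Degree-j part of I \<otimes>_S K(x)_i: coefficient of e_F lies in I and is homogeneous
  of degree j - i.\<close>
definition koszul_chains :: "('v::{finite,linorder}, 'k::comm_ring_1) mpoly set \<Rightarrow> nat \<Rightarrow> int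
                              \<Rightarrow> ('v set \<Rightarrow> ('v, 'k) mpoly) set" where
  "koszul_chains I i j = {c. \<forall>F. (card F \<noteq> i \<longrightarrow> c F = 0)
                                \<and> c F \<in> I \<and> homogeneous (j - int i) (c F)}"

text \<open>Tor_i^S(I,K)_j \<noteq> 0, i.e. the homology (cycles modulo boundaries) in homological
  degree i and internal degree j is a nonzero K-vector space.\<close>
definition tor_nonzero :: "('v::{finite,linorder}, 'k::field) mpoly set \<Rightarrow> nat \<Rightarrow> int \<Rightarrow> bool" where
  "tor_nonzero I i j \<longleftrightarrow>
     \<not> ({c \<in> koszul_chains I i j. koszul_d c = (\<lambda>_. 0)}
         \<subseteq> koszul_d ` koszul_chains I (Suc i) j)"

definition reg :: "('v::{finite,linorder}, 'k::field) mpoly set \<Rightarrow> int" where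
  "reg I = (if I = {0} then 1
            else Max {j - int i | i j. tor_nonzero I i j})"

end

theory Submission
  imports Defs
begin

text \<open>
  Only squarefree monomial ideals occur; such an ideal is recorded by the up-closed family \<open>U\<close> of the
  supports of its monomials. For a vertex \<open>x\<close>, the Mayer--Vietoris sequence of
  \<open>U = del x U + x \<sqdot> link x U\<close>, where \<open>del x U \<inter> x \<sqdot> link x U = x \<sqdot> del x U\<close>, gives
  \<open>reg U \<le> max (reg (del x U)) (reg (link x U) + 1)\<close>.

  Applied to \<open>I(G)\<close> this yields \<open>reg I(G) \<le> \<nu>(G) + 1\<close>, because an edge at \<open>x\<close> extends every matching of
  \<open>G - N[x]\<close>. For \<open>I(G)\<^sup>[\<^sup>2\<^sup>]\<close> split at \<open>x\<close> and then at the neighbours \<open>y\<close> of \<open>x\<close> one after the other.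
  What remains is \<open>I(G - N[x])\<^sup>[\<^sup>2\<^sup>]\<close>, where \<open>\<nu>\<close> has dropped, and the colon ideals by \<open>x y\<close>. Such a colon
  ideal is the edge ideal of \<open>G - x - y\<close> together with all \<open>a b\<close> with \<open>a \<in> N(x)\<close>, \<open>b \<in> N(y)\<close>,
  \<open>a \<noteq> b\<close>. Its regularity is at most \<open>\<nu>(G)\<close>: splitting at such an \<open>a\<close>, the link no longer meets \<open>N(y)\<close>, so
  each of its matchings extends by both \<open>x a\<close> and \<open>y b\<close>.
\<close>

section \<open>Polynomials and the Koszul differential\<close>

lemma poly_mapping_sum_monomials:
  "(\<Sum>m\<in>Poly_Mapping.keys p. Poly_Mapping.single m (Poly_Mapping.lookup p m)) = p"
  by (rule poly_mapping_eqI)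
    (auto simp: lookup_sum lookup_single when_def in_keys_iff)

text \<open>Exponent subtraction is truncated; the test on \<open>k\<close> ensures that
  \<open>m - single k 1\<close> is the true quotient.\<close>

lemma lookup_var_mult:
  "Poly_Mapping.lookup (var k * p) m =
    (if k \<in> Poly_Mapping.keys m then Poly_Mapping.lookup p (m - Poly_Mapping.single k 1) else 0)"
proof -
  have "var k * p = (\<Sum>n\<in>Poly_Mapping.keys p.
      Poly_Mapping.single (Poly_Mapping.single k 1 + n) (Poly_Mapping.lookup p n))"
    by (subst (1) poly_mapping_sum_monomials[of p, symmetric])
      (simp add: var_def sum_distrib_left mult_single)
  then have 1: "Poly_Mapping.lookup (var k * p) m = (\<Sum>n\<in>Poly_Mapping.keys p.
      if Poly_Mapping.single k 1 + n = m then Poly_Mapping.lookup p n else 0)"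
    by (simp add: lookup_sum lookup_single when_def)
  have *: "Poly_Mapping.single k 1 + n = m \<longleftrightarrow>
      k \<in> Poly_Mapping.keys m \<and> n = m - Poly_Mapping.single k 1" for n
  proof
    assume "Poly_Mapping.single k 1 + n = m"
    then show "k \<in> Poly_Mapping.keys m \<and> n = m - Poly_Mapping.single k 1"
      by (auto simp: in_keys_iff lookup_add)
  next
    assume "k \<in> Poly_Mapping.keys m \<and> n = m - Poly_Mapping.single k 1"
    then show "Poly_Mapping.single k 1 + n = m"
      by (intro poly_mapping_eqI)
        (auto simp: in_keys_iff lookup_add lookup_minus lookup_single when_def)
  qed
  show ?thesis
    unfolding 1 * by (auto simp: in_keys_iff)
qed

lemma keys_monomial_add:
  fixes m n :: "'v \<Rightarrow>\<^sub>0 nat"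
  shows "Poly_Mapping.keys (m + n) = Poly_Mapping.keys m \<union> Poly_Mapping.keys n"
  by (auto simp: in_keys_iff lookup_add)

lemma mdeg_add: "mdeg (m + n) = mdeg m + mdeg n"
  by (simp add: mdeg_def lookup_add sum.distrib)

lemma mdeg_single: "mdeg (Poly_Mapping.single k n) = n"
  by (simp add: mdeg_def lookup_single when_def)

text \<open>Divides the terms that contain \<open>x\<close> by \<open>x\<close> and drops the
  others: a linear left inverse of multiplication by \<open>var x\<close>.\<close>

definition div_var :: "'v \<Rightarrow> ('v, 'k::comm_ring_1) mpoly \<Rightarrow> ('v, 'k) mpoly" where
  "div_var x = Poly_Mapping.map_key ((+) (Poly_Mapping.single x 1))"

lemma lookup_div_var:
  "Poly_Mapping.lookup (div_var x p) m = Poly_Mapping.lookup p (Poly_Mapping.single x 1 + m)"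
  by (simp add: div_var_def map_key.rep_eq)

lemma div_var_add: "div_var x (p + q) = div_var x p + div_var x q"
  by (rule poly_mapping_eqI) (simp add: lookup_div_var lookup_add)

lemma div_var_uminus: "div_var x (- p) = - div_var x p"
  by (rule poly_mapping_eqI) (simp add: lookup_div_var)

lemma div_var_0 [simp]: "div_var x 0 = 0"
  by (rule poly_mapping_eqI) (simp add: lookup_div_var)

lemma div_var_sum: "div_var x (sum f A) = (\<Sum>a\<in>A. div_var x (f a))"
  by (rule poly_mapping_eqI) (simp add: lookup_div_var lookup_sum)

lemma div_var_var_mult [simp]: "div_var x (var x * p) = p"
  by (rule poly_mapping_eqI) (simp add: lookup_div_var lookup_var_mult in_keys_iff lookup_add)

lemma div_var_var_mult_neq:
  fixes p :: "('v, 'k::comm_ring_1) mpoly"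
  assumes "k \<noteq> x"
  shows "div_var x (var k * p) = var k * div_var x p"
proof (rule poly_mapping_eqI)
  fix m :: "'v \<Rightarrow>\<^sub>0 nat"
  note assms
  moreover have "Poly_Mapping.single x 1 + m - Poly_Mapping.single k 1 =
      Poly_Mapping.single x 1 + (m - Poly_Mapping.single k 1)" if "k \<in> Poly_Mapping.keys m"
    using that \<open>k \<noteq> x\<close> by (intro poly_mapping_eqI)
      (auto simp: lookup_add lookup_minus lookup_single when_def in_keys_iff)
  ultimately show "Poly_Mapping.lookup (div_var x (var k * p)) m =
      Poly_Mapping.lookup (var k * div_var x p) m"
    by (auto simp: lookup_div_var lookup_var_mult in_keys_iff lookup_add lookup_single)
qed

lemma var_mult_div_var:
  "Poly_Mapping.lookup (var x * div_var x p) m =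
    (if x \<in> Poly_Mapping.keys m then Poly_Mapping.lookup p m else 0)"
proof -
  have "Poly_Mapping.single x 1 + (m - Poly_Mapping.single x 1) = m" if "x \<in> Poly_Mapping.keys m"
    using that by (intro poly_mapping_eqI)
      (auto simp: lookup_add lookup_minus lookup_single when_def in_keys_iff)
  then show ?thesis by (simp add: lookup_var_mult lookup_div_var)
qed

lemma homogeneous_lookup:
  "homogeneous d p \<longleftrightarrow> (\<forall>m. Poly_Mapping.lookup p m \<noteq> 0 \<longrightarrow> int (mdeg m) = d)"
  by (auto simp: homogeneous_def in_keys_iff)

lemma mdeg_minus_single:
  assumes "k \<in> Poly_Mapping.keys m"
  shows "mdeg m = Suc (mdeg (m - Poly_Mapping.single k 1))"
proof -
  have "m = Poly_Mapping.single k 1 + (m - Poly_Mapping.single k 1)"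
    using assms by (intro poly_mapping_eqI)
      (auto simp: lookup_add lookup_minus lookup_single when_def in_keys_iff)
  then show ?thesis by (metis mdeg_add mdeg_single plus_1_eq_Suc)
qed

section \<open>Koszul signs and the square of the differential\<close>

lemma koszul_sign_sq [simp]: "koszul_sign k F * koszul_sign k F = 1"
  by (simp add: koszul_sign_def)

lemma single_koszul_sign:
  "(Poly_Mapping.single 0 (koszul_sign k F) :: ('v::linorder, 'k::comm_ring_1) mpoly) = koszul_sign k F"
  unfolding koszul_sign_def
  by (cases "even (card {l \<in> F. l < k})") (simp_all add: single_uminus)

lemma koszul_sign_insert_self [simp]: "koszul_sign k (insert k F) = koszul_sign k F"
  unfolding koszul_sign_def by (rule arg_cong[where f = "\<lambda>A. (-1) ^ card A"]) auto

lemma koszul_sign_insert: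
  fixes F :: "'v::{finite,linorder} set"
  assumes "l \<notin> F"
  shows "koszul_sign k (insert l F) = (if l < k then - koszul_sign k F else koszul_sign k F)"
proof (cases "l < k")
  case True
  then have "{j \<in> insert l F. j < k} = insert l {j \<in> F. j < k}" by auto
  then show ?thesis using assms True by (simp add: koszul_sign_def)
next
  case False
  then have "{j \<in> insert l F. j < k} = {j \<in> F. j < k}" by auto
  then show ?thesis using False by (simp add: koszul_sign_def)
qed

text \<open>One of \<open>k\<close> and \<open>l\<close> lies below the other, so exactly one of the
  two insertions flips a sign.\<close>

lemma koszul_sign_swap:
  fixes F :: "'v::{finite,linorder} set"
  assumes "k \<notin> F" "l \<notin> F" "k \<noteq> l"
  shows "koszul_sign k F * koszul_sign l (insert k F) =
    - (koszul_sign l F * koszul_sign k (insert l F))"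
  using assms by (auto simp: koszul_sign_insert mult.commute not_less_iff_gr_or_eq)

lemma koszul_d_alt:
  "koszul_d c G = (\<Sum>k\<in>- G. koszul_sign k G * (var k * c (insert k G)))"
  by (simp add: koszul_d_def single_koszul_sign mult.assoc Compl_eq_Diff_UNIV)

text \<open>Terms above and below the diagonal cancel in pairs. Showing only that the sum equals its
  negative would fail in characteristic 2.\<close>

lemma sum_antisymmetric_0:
  fixes f :: "'a::linorder \<Rightarrow> 'a \<Rightarrow> 'b::ab_group_add"
  assumes "\<And>k l. k \<in> A \<Longrightarrow> l \<in> A \<Longrightarrow> k \<noteq> l \<Longrightarrow> f k l = - f l k"
    and "\<And>k. k \<in> A \<Longrightarrow> f k k = 0"
  shows "(\<Sum>k\<in>A. \<Sum>l\<in>A. f k l) = 0"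
proof -
  have "(\<Sum>k\<in>A. \<Sum>l\<in>A. f k l) =
      (\<Sum>k\<in>A. \<Sum>l\<in>A. (if k < l then f k l else 0) + (if l < k then f k l else 0))"
    using assms(2) by (intro sum.cong refl) (metis add.left_neutral add.right_neutral antisym_conv3 not_less_iff_gr_or_eq)
  also have "\<dots> = (\<Sum>k\<in>A. \<Sum>l\<in>A. if k < l then f k l else 0) +
      (\<Sum>k\<in>A. \<Sum>l\<in>A. if l < k then f k l else 0)"
    by (simp add: sum.distrib)
  also have "(\<Sum>k\<in>A. \<Sum>l\<in>A. if l < k then f k l else 0) =
      (\<Sum>l\<in>A. \<Sum>k\<in>A. if l < k then f k l else 0)"
    by (rule sum.swap)
  also have "\<dots> = (\<Sum>l\<in>A. \<Sum>k\<in>A. - (if l < k then f l k else 0))"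
  proof (intro sum.cong refl)
    fix l k assume "l \<in> A" "k \<in> A"
    then show "(if l < k then f k l else 0) = - (if l < k then f l k else 0)"
      using assms(1)[of k l] by (cases "l < k") auto
  qed
  also have "\<dots> = - (\<Sum>k\<in>A. \<Sum>l\<in>A. if k < l then f k l else 0)"
    by (simp add: sum_negf)
  finally show ?thesis by simp
qed

lemma koszul_d_koszul_d: "koszul_d (koszul_d c) = (\<lambda>_. 0)"
proof
  fix G
  \<comment> \<open>Zero on the diagonal, so that the inner sum may run over all of
    \<open>- G\<close>.\<close>
  define f where "f k l = (if k = l then 0 else
    koszul_sign k G * koszul_sign l (insert k G) * (var k * (var l * c (insert l (insert k G)))))" for k l
  have "koszul_d (koszul_d c) G = (\<Sum>k\<in>- G. \<Sum>l\<in>- insert k G. f k l)"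
    unfolding koszul_d_alt sum_distrib_left
  proof (intro sum.cong refl)
    fix k l assume "k \<in> - G" "l \<in> - insert k G"
    then show "koszul_sign k G * (var k * (koszul_sign l (insert k G) *
        (var l * c (insert l (insert k G))))) = f k l"
      by (auto simp: f_def mult_ac)
  qed
  also have "\<dots> = (\<Sum>k\<in>- G. \<Sum>l\<in>- G. f k l)"
    by (intro sum.cong refl sum.mono_neutral_left) (auto simp: f_def)
  also have "\<dots> = 0"
  proof (rule sum_antisymmetric_0)
    fix k l assume kl: "k \<in> - G" "l \<in> - G" "k \<noteq> l"
    then have "koszul_sign k G * koszul_sign l (insert k G) =
      - (koszul_sign l G * (koszul_sign k (insert l G) :: ('a, 'b) mpoly))"
      by (intro koszul_sign_swap) auto
    then show "f k l = - f l k"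
      using kl by (simp add: f_def insert_commute mult.left_commute)
  qed (simp add: f_def)
  finally show "koszul_d (koszul_d c) G = 0" .
qed

lemma koszul_d_add: "koszul_d (\<lambda>F. a F + b F) = (\<lambda>G. koszul_d a G + koszul_d b G)"
  by (rule ext) (simp add: koszul_d_alt algebra_simps sum.distrib)

lemma koszul_d_diff: "koszul_d (\<lambda>F. a F - b F) = (\<lambda>G. koszul_d a G - koszul_d b G)"
  by (rule ext) (simp add: koszul_d_alt algebra_simps sum_subtractf)

lemma koszul_d_mult: "koszul_d (\<lambda>F. p * a F) = (\<lambda>G. p * koszul_d a G)"
  by (rule ext) (simp add: koszul_d_alt sum_distrib_left mult_ac)

section \<open>Regularity of squarefree monomial ideals\<close>

text \<open>For up-closed \<open>U\<close> this is the Stanley-Reisner ideal of the complex of sets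
  outside \<open>U\<close>; \<open>UNIV\<close> gives the whole ring and \<open>{}\<close> the zero
  ideal.\<close>

definition sr_ideal :: "'v set set \<Rightarrow> ('v, 'k::comm_ring_1) mpoly set" where
  "sr_ideal U = {p. \<forall>m\<in>Poly_Mapping.keys p. Poly_Mapping.keys m \<in> U}"

definition up_closed :: "'v set set \<Rightarrow> bool" where
  "up_closed U \<longleftrightarrow> (\<forall>F F'. F \<in> U \<longrightarrow> F \<subseteq> F' \<longrightarrow> F' \<in> U)"

lemma up_closedD: "up_closed U \<Longrightarrow> F \<in> U \<Longrightarrow> F \<subseteq> F' \<Longrightarrow> F' \<in> U"
  unfolding up_closed_def by blast

lemma sr_ideal_lookup:
  "p \<in> sr_ideal U \<longleftrightarrow> (\<forall>m. Poly_Mapping.lookup p m \<noteq> 0 \<longrightarrow> Poly_Mapping.keys m \<in> U)"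
  by (auto simp: sr_ideal_def in_keys_iff)

lemma sr_ideal_0 [simp]: "0 \<in> sr_ideal U"
  by (simp add: sr_ideal_def)

lemma keys_minus_single_subset:
  "Poly_Mapping.keys (m - Poly_Mapping.single k (1::nat)) \<subseteq> Poly_Mapping.keys m"
  by (auto simp: in_keys_iff lookup_minus)

lemma koszul_sign_mult_cases: "koszul_sign k F * p = p \<or> koszul_sign k F * p = - p"
  unfolding koszul_sign_def by (cases "even (card {l \<in> F. l < k})") auto

lemma koszul_chains_iff:
  "c \<in> koszul_chains (sr_ideal U) i j \<longleftrightarrow>
    (\<forall>F m. Poly_Mapping.lookup (c F) m \<noteq> 0 \<longrightarrow>
      card F = i \<and> Poly_Mapping.keys m \<in> U \<and> int (mdeg m) = j - int i)"
proof -
  have "c F = 0 \<longleftrightarrow> (\<forall>m. Poly_Mapping.lookup (c F) m = 0)" for F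
    by (metis lookup_zero poly_mapping_eqI)
  then show ?thesis
    unfolding koszul_chains_def sr_ideal_lookup homogeneous_lookup mem_Collect_eq by metis
qed

lemma koszul_chains_add:
  "a \<in> koszul_chains (sr_ideal U) i j \<Longrightarrow> b \<in> koszul_chains (sr_ideal U) i j \<Longrightarrow>
    (\<lambda>F. a F + b F) \<in> koszul_chains (sr_ideal U) i j"
  unfolding koszul_chains_iff lookup_add by (metis add.right_neutral)

lemma koszul_chains_diff:
  "a \<in> koszul_chains (sr_ideal U) i j \<Longrightarrow> b \<in> koszul_chains (sr_ideal U) i j \<Longrightarrow>
    (\<lambda>F. a F - b F) \<in> koszul_chains (sr_ideal U) i j"
  unfolding koszul_chains_iff lookup_minus by (metis diff_0_right)

lemma koszul_chains_mono:
  "a \<in> koszul_chains (sr_ideal U) i j \<Longrightarrow> U \<subseteq> V \<Longrightarrow> a \<in> koszul_chains (sr_ideal V) i j"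
  unfolding koszul_chains_iff by blast

lemma koszul_chains_Int:
  "c \<in> koszul_chains (sr_ideal (A \<inter> B)) i j \<longleftrightarrow>
    c \<in> koszul_chains (sr_ideal A) i j \<and> c \<in> koszul_chains (sr_ideal B) i j"
  unfolding koszul_chains_iff by blast

text \<open>Surjectivity in the short exact sequence behind Mayer-Vietoris: \<open>a\<close> keeps
  the terms with support in \<open>A\<close>, and what is left has support in
  \<open>B\<close>.\<close>

lemma koszul_chains_Un:
  fixes c :: "'v::{finite,linorder} set \<Rightarrow> ('v, 'k::comm_ring_1) mpoly"
  assumes "c \<in> koszul_chains (sr_ideal (A \<union> B)) i j"
  obtains a b where "a \<in> koszul_chains (sr_ideal A) i j" "b \<in> koszul_chains (sr_ideal B) i j"
    "c = (\<lambda>F. a F + b F)"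
proof
  define a where "a F = (\<Sum>m\<in>{m \<in> Poly_Mapping.keys (c F). Poly_Mapping.keys m \<in> A}.
    Poly_Mapping.single m (Poly_Mapping.lookup (c F) m))" for F
  have a: "Poly_Mapping.lookup (a F) m =
      (if Poly_Mapping.keys m \<in> A then Poly_Mapping.lookup (c F) m else 0)" for F m
    by (auto simp: a_def lookup_sum lookup_single when_def in_keys_iff)
  show "a \<in> koszul_chains (sr_ideal A) i j"
    using assms by (auto simp: koszul_chains_iff a)
  show "(\<lambda>F. c F - a F) \<in> koszul_chains (sr_ideal B) i j"
    using assms by (auto simp: koszul_chains_iff lookup_minus a)
  show "c = (\<lambda>F. a F + (c F - a F))" by simp
qed

lemma lookup_koszul_d_nonzero:
  assumes "Poly_Mapping.lookup (koszul_d c G) m \<noteq> 0"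
  obtains k where "k \<notin> G" "k \<in> Poly_Mapping.keys m"
    "Poly_Mapping.lookup (c (insert k G)) (m - Poly_Mapping.single k 1) \<noteq> 0"
proof -
  obtain k where k: "k \<in> - G"
    "Poly_Mapping.lookup (koszul_sign k G * (var k * c (insert k G))) m \<noteq> 0"
    using assms unfolding koszul_d_alt lookup_sum by (meson sum.neutral)
  then have "Poly_Mapping.lookup (var k * c (insert k G)) m \<noteq> 0"
    using koszul_sign_mult_cases[of k G "var k * c (insert k G)"] by auto
  then show ?thesis
    using that k(1) by (auto simp: lookup_var_mult split: if_splits)
qed

text \<open>Multiplying by a variable can only enlarge a support, and \<open>U\<close> is up-closed.
  A coefficient gains one degree as its index set loses one element, so \<open>j\<close> stays
  fixed.\<close>

lemma koszul_d_chains: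
  assumes "up_closed U" "c \<in> koszul_chains (sr_ideal U) (Suc i) j"
  shows "koszul_d c \<in> koszul_chains (sr_ideal U) i j"
  unfolding koszul_chains_iff
proof (intro allI impI)
  fix G m assume "Poly_Mapping.lookup (koszul_d c G) m \<noteq> 0"
  then obtain k where k: "k \<notin> G" "k \<in> Poly_Mapping.keys m"
    "Poly_Mapping.lookup (c (insert k G)) (m - Poly_Mapping.single k 1) \<noteq> 0"
    by (rule lookup_koszul_d_nonzero)
  then have "card (insert k G) = Suc i" "Poly_Mapping.keys (m - Poly_Mapping.single k 1) \<in> U"
    "int (mdeg (m - Poly_Mapping.single k 1)) = j - int (Suc i)"
    using assms(2) unfolding koszul_chains_iff by blast+
  then show "card G = i \<and> Poly_Mapping.keys m \<in> U \<and> int (mdeg m) = j - int i"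
    using k(1) mdeg_minus_single[OF k(2)] up_closedD[OF assms(1) _ keys_minus_single_subset]
    by auto
qed

lemma koszul_d_chains_0:
  assumes "c \<in> koszul_chains (sr_ideal U) 0 j"
  shows "koszul_d c = (\<lambda>_. 0)"
proof (intro ext poly_mapping_eqI)
  fix G m
  show "Poly_Mapping.lookup (koszul_d c G) m = Poly_Mapping.lookup 0 m"
    using assms lookup_koszul_d_nonzero[of c G m] unfolding koszul_chains_iff
    by (metis card_0_eq finite insert_not_empty lookup_zero)
qed

text \<open>The first argument only carries the coefficient field.\<close>

definition reg_le :: "'k::field itself \<Rightarrow> 'v::{finite,linorder} set set \<Rightarrow> int \<Rightarrow> bool" where
  "reg_le K U r \<longleftrightarrow>
    (\<forall>i j. tor_nonzero (sr_ideal U :: ('v, 'k) mpoly set) i j \<longrightarrow> j - int i \<le> r)"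

lemma reg_leI:
  fixes K :: "'k::field itself" and U :: "'v::{finite,linorder} set set"
  assumes "\<And>i j c. r < j - int i \<Longrightarrow> (c :: 'v set \<Rightarrow> ('v, 'k) mpoly) \<in> koszul_chains (sr_ideal U) i j \<Longrightarrow>
    koszul_d c = (\<lambda>_. 0) \<Longrightarrow> \<exists>b\<in>koszul_chains (sr_ideal U) (Suc i) j. c = koszul_d b"
  shows "reg_le K U r"
  unfolding reg_le_def tor_nonzero_def
proof (intro allI impI, rule ccontr)
  fix i j
  assume "\<not> {c \<in> koszul_chains (sr_ideal U :: ('v, 'k) mpoly set) i j. koszul_d c = (\<lambda>_. 0)}
      \<subseteq> koszul_d ` koszul_chains (sr_ideal U) (Suc i) j"
    and "\<not> j - int i \<le> r"
  then show False using assms[of j i] by auto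
qed

lemma reg_leD:
  fixes K :: "'k::field itself" and c :: "'v::{finite,linorder} set \<Rightarrow> ('v, 'k) mpoly"
  assumes "reg_le K U r" "r < j - int i" "c \<in> koszul_chains (sr_ideal U) i j"
    "koszul_d c = (\<lambda>_. 0)"
  obtains b where "b \<in> koszul_chains (sr_ideal U) (Suc i) j" "c = koszul_d b"
proof -
  have "\<not> tor_nonzero (sr_ideal U :: ('v, 'k) mpoly set) i j"
    using assms(1,2) unfolding reg_le_def by force
  then show ?thesis
    using that assms(3,4) unfolding tor_nonzero_def by blast
qed

section \<open>Mayer-Vietoris and splitting at a vertex\<close>

lemma reg_le_mono: "reg_le K U r \<Longrightarrow> r \<le> s \<Longrightarrow> reg_le K U s"
  unfolding reg_le_def by force

text \<open>Mayer-Vietoris at the level of chains. The connecting map lowers the homological degree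
  by one and keeps \<open>j\<close>, so the weaker bound \<open>r + 1\<close> suffices for the
  intersection.\<close>

lemma reg_le_Un:
  fixes K :: "'k::field itself" and A B :: "'v::{finite,linorder} set set"
  assumes "up_closed A" "up_closed B"
    and A: "reg_le K A r" and B: "reg_le K B r" and AB: "reg_le K (A \<inter> B) (r + 1)"
  shows "reg_le K (A \<union> B) r"
proof (rule reg_leI)
  fix i j and c :: "'v set \<Rightarrow> ('v, 'k) mpoly"
  assume r: "r < j - int i" and c: "c \<in> koszul_chains (sr_ideal (A \<union> B)) i j"
    and cycle: "koszul_d c = (\<lambda>_. 0)"
  obtain a b where a: "a \<in> koszul_chains (sr_ideal A) i j"
    and b: "b \<in> koszul_chains (sr_ideal B) i j" and ab: "c = (\<lambda>F. a F + b F)"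
    using koszul_chains_Un[OF c] .
  have sum0: "koszul_d a G + koszul_d b G = 0" for G
    using cycle unfolding ab koszul_d_add by meson
  \<comment> \<open>The boundaries of \<open>a\<close> and \<open>b\<close> are opposite, so they
    lie over both \<open>A\<close> and \<open>B\<close>. Once \<open>e\<close> fills the boundary of
    \<open>a\<close> over the intersection, \<open>a - e\<close> and \<open>b + e\<close> are cycles
    with sum \<open>c\<close>.\<close>
  have "\<exists>e\<in>koszul_chains (sr_ideal (A \<inter> B)) i j. koszul_d a = koszul_d e"
  proof (cases i)
    case 0
    then have "koszul_d a = (\<lambda>_. 0)" using a koszul_d_chains_0 by blast
    moreover have "koszul_d (\<lambda>_. 0) = (\<lambda>_. 0 :: ('v, 'k) mpoly)"
      by (rule ext) (simp add: koszul_d_alt)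
    moreover have "(\<lambda>_. 0) \<in> koszul_chains (sr_ideal (A \<inter> B)) i j"
      by (simp add: koszul_chains_iff)
    ultimately show ?thesis by metis
  next
    case (Suc i')
    have "koszul_d a = (\<lambda>F. 0 - koszul_d b F)"
      using sum0 by (intro ext) (simp add: eq_neg_iff_add_eq_0)
    moreover have "koszul_d b \<in> koszul_chains (sr_ideal B) i' j"
      using koszul_d_chains[OF assms(2)] b Suc by blast
    moreover have "(\<lambda>_. 0) \<in> koszul_chains (sr_ideal B) i' j"
      by (simp add: koszul_chains_iff)
    ultimately have "koszul_d a \<in> koszul_chains (sr_ideal B) i' j"
      using koszul_chains_diff[of "\<lambda>_. 0" B i' j "koszul_d b"] by simp
    moreover have "koszul_d a \<in> koszul_chains (sr_ideal A) i' j"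
      using koszul_d_chains[OF assms(1)] a Suc by blast
    ultimately have da: "koszul_d a \<in> koszul_chains (sr_ideal (A \<inter> B)) i' j"
      by (simp add: koszul_chains_Int)
    \<comment> \<open>The cycle \<open>koszul_d a\<close> has homological degree
      \<open>i - 1\<close>, which gains the one that the bound for the intersection costs.\<close>
    have "r + 1 < j - int i'" using r Suc by simp
    from reg_leD[OF AB this da koszul_d_koszul_d] show ?thesis
      using Suc by blast
  qed
  then obtain e where e: "e \<in> koszul_chains (sr_ideal (A \<inter> B)) i j" and de: "koszul_d a = koszul_d e"
    by blast
  have "(\<lambda>F. a F - e F) \<in> koszul_chains (sr_ideal A) i j"
    using a e koszul_chains_Int koszul_chains_diff by blast
  moreover have "koszul_d (\<lambda>F. a F - e F) = (\<lambda>_. 0)"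
    by (simp add: koszul_d_diff de)
  ultimately obtain a' where a': "a' \<in> koszul_chains (sr_ideal A) (Suc i) j"
    "(\<lambda>F. a F - e F) = koszul_d a'"
    by (rule reg_leD[OF A r])
  have "(\<lambda>F. b F + e F) \<in> koszul_chains (sr_ideal B) i j"
    using b e koszul_chains_Int koszul_chains_add by blast
  moreover have "koszul_d (\<lambda>F. b F + e F) = (\<lambda>_. 0)"
    using sum0 by (simp add: koszul_d_add de[symmetric] add.commute)
  ultimately obtain b' where b': "b' \<in> koszul_chains (sr_ideal B) (Suc i) j"
    "(\<lambda>F. b F + e F) = koszul_d b'"
    by (rule reg_leD[OF B r])
  have "(\<lambda>F. a' F + b' F) \<in> koszul_chains (sr_ideal (A \<union> B)) (Suc i) j"
    by (intro koszul_chains_add koszul_chains_mono[OF a'(1)] koszul_chains_mono[OF b'(1)]) auto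
  moreover have "c = koszul_d (\<lambda>F. a' F + b' F)"
    unfolding koszul_d_add a'(2)[symmetric] b'(2)[symmetric] ab by simp
  ultimately show "\<exists>b\<in>koszul_chains (sr_ideal (A \<union> B)) (Suc i) j. c = koszul_d b" by blast
qed

text \<open>\<open>link x U\<close> is the colon ideal by the variable \<open>x\<close>; \<open>del x U\<close> is generated by the monomials of \<open>U\<close>
  that do not involve \<open>x\<close>.\<close>

definition link :: "'v \<Rightarrow> 'v set set \<Rightarrow> 'v set set" where
  "link x U = {F. insert x F \<in> U}"

definition del :: "'v \<Rightarrow> 'v set set \<Rightarrow> 'v set set" where
  "del x U = {F. F - {x} \<in> U}"

text \<open>The monomials of \<open>U\<close> containing \<open>x\<close> span \<open>x\<close>
  times the ideal of \<open>link x U\<close>. Multiplication by \<open>x\<close> is an isomorphism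
  of complexes raising the internal degree by one, with inverse \<open>div_var x\<close>.\<close>

lemma reg_le_var_mult:
  fixes K :: "'k::field itself" and U :: "'v::{finite,linorder} set set"
  assumes "reg_le K (link x U) r"
  shows "reg_le K {F \<in> U. x \<in> F} (r + 1)"
proof (rule reg_leI)
  fix i j and c :: "'v set \<Rightarrow> ('v, 'k) mpoly"
  assume r: "r + 1 < j - int i" and c: "c \<in> koszul_chains (sr_ideal {F \<in> U. x \<in> F}) i j"
    and cycle: "koszul_d c = (\<lambda>_. 0)"
  have cF: "c F = var x * div_var x (c F)" for F
    using c by (intro poly_mapping_eqI) (auto simp: var_mult_div_var koszul_chains_iff)
  have "(\<lambda>F. div_var x (c F)) \<in> koszul_chains (sr_ideal (link x U)) i (j - 1)"
    unfolding koszul_chains_iff lookup_div_var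
  proof (intro allI impI)
    fix F m assume "Poly_Mapping.lookup (c F) (Poly_Mapping.single x 1 + m) \<noteq> 0"
    then have "card F = i \<and> Poly_Mapping.keys (Poly_Mapping.single x 1 + m) \<in> {F \<in> U. x \<in> F} \<and>
        int (mdeg (Poly_Mapping.single x 1 + m)) = j - int i"
      using c unfolding koszul_chains_iff by blast
    then show "card F = i \<and> Poly_Mapping.keys m \<in> link x U \<and> int (mdeg m) = j - 1 - int i"
      by (auto simp: link_def keys_monomial_add mdeg_add mdeg_single)
  qed
  moreover have "koszul_d (\<lambda>F. div_var x (c F)) = (\<lambda>_. 0)"
  proof
    fix G
    have "koszul_d c = koszul_d (\<lambda>F. var x * div_var x (c F))" using cF by simp
    then have "var x * koszul_d (\<lambda>F. div_var x (c F)) G = 0"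
      using cycle unfolding koszul_d_mult by metis
    then show "koszul_d (\<lambda>F. div_var x (c F)) G = 0"
      by (metis div_var_0 div_var_var_mult)
  qed
  moreover have "r < j - 1 - int i" using r by simp
  ultimately obtain b where b: "b \<in> koszul_chains (sr_ideal (link x U)) (Suc i) (j - 1)"
    "(\<lambda>F. div_var x (c F)) = koszul_d b"
    using reg_leD[OF assms] by metis
  have "(\<lambda>F. var x * b F) \<in> koszul_chains (sr_ideal {F \<in> U. x \<in> F}) (Suc i) j"
    unfolding koszul_chains_iff
  proof (intro allI impI)
    fix F m assume "Poly_Mapping.lookup (var x * b F) m \<noteq> 0"
    then have m: "x \<in> Poly_Mapping.keys m" "Poly_Mapping.lookup (b F) (m - Poly_Mapping.single x 1) \<noteq> 0"
      by (auto simp: lookup_var_mult split: if_splits)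
    then have "card F = Suc i" "Poly_Mapping.keys (m - Poly_Mapping.single x 1) \<in> link x U"
      "int (mdeg (m - Poly_Mapping.single x 1)) = j - 1 - int (Suc i)"
      using b(1) unfolding koszul_chains_iff by blast+
    moreover have "insert x (Poly_Mapping.keys (m - Poly_Mapping.single x 1)) = Poly_Mapping.keys m"
      using m(1) by (auto simp: in_keys_iff lookup_minus lookup_single when_def split: if_splits)
    ultimately show "card F = Suc i \<and> Poly_Mapping.keys m \<in> {F \<in> U. x \<in> F} \<and>
        int (mdeg m) = j - int (Suc i)"
      using mdeg_minus_single[OF m(1)] m(1) by (auto simp: link_def)
  qed
  moreover have "c = koszul_d (\<lambda>F. var x * b F)"
    unfolding koszul_d_mult b(2)[symmetric] using cF by blast
  ultimately show "\<exists>b\<in>koszul_chains (sr_ideal {F \<in> U. x \<in> F}) (Suc i) j. c = koszul_d b" by blast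
qed

lemma up_closed_link: "up_closed U \<Longrightarrow> up_closed (link x U)"
  unfolding up_closed_def link_def mem_Collect_eq by (meson insert_mono)

lemma up_closed_del: "up_closed U \<Longrightarrow> up_closed (del x U)"
  unfolding up_closed_def del_def mem_Collect_eq by (meson Diff_mono order_refl)

lemma reg_le_link_del:
  assumes U: "up_closed U" and "reg_le K (link x U) r" "reg_le K (del x U) (r + 1)"
  shows "reg_le K U (r + 1)"
proof -
  have dU: "del x U \<subseteq> U"
    using up_closedD[OF U] by (auto simp: del_def)
  have "del x U \<union> {F \<in> U. x \<in> F} = U"
    using dU by (auto simp: del_def)
  moreover have "reg_le K (del x U \<union> {F \<in> U. x \<in> F}) (r + 1)"
  proof (rule reg_le_Un)
    show "up_closed {F \<in> U. x \<in> F}" using U unfolding up_closed_def by blast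
    \<comment> \<open>Hence the intersection is \<open>x\<close> times the ideal of
      \<open>del x U\<close>, and its bound \<open>r + 2\<close> is what Mayer-Vietoris
      allows.\<close>
    have "link x (del x U) = del x U" by (auto simp: link_def del_def)
    moreover have "{F \<in> del x U. x \<in> F} = del x U \<inter> {F \<in> U. x \<in> F}" using dU by auto
    ultimately show "reg_le K (del x U \<inter> {F \<in> U. x \<in> F}) (r + 1 + 1)"
      using reg_le_var_mult[of K x "del x U" "r + 1"] assms by simp
  qed (use assms in \<open>auto intro: up_closed_del reg_le_var_mult\<close>)
  ultimately show ?thesis by simp
qed

section \<open>Contracting the Koszul complex of the polynomial ring\<close>

lemma div_var_koszul_sign_mult: "div_var x (koszul_sign k F * p) = koszul_sign k F * div_var x p"
  unfolding koszul_sign_def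
  by (cases "even (card {l \<in> F. l < k})") (simp_all add: div_var_uminus)

text \<open>Moving a term from \<open>F\<close> to \<open>insert x F\<close> while dividing it by
  \<open>x\<close>, up to sign, is a homotopy between the identity and the projection to the terms
  free of \<open>x\<close>. On a cycle only that projection remains.\<close>

lemma koszul_contract_var:
  fixes c :: "'v::{finite,linorder} set \<Rightarrow> ('v, 'k::comm_ring_1) mpoly"
  assumes c: "c \<in> koszul_chains (sr_ideal UNIV) i j" and cycle: "koszul_d c = (\<lambda>_. 0)"
  obtains h where "h \<in> koszul_chains (sr_ideal UNIV) (Suc i) j"
    and "\<And>G m. Poly_Mapping.lookup (c G - koszul_d h G) m =
      (if x \<in> G \<or> x \<in> Poly_Mapping.keys m then 0 else Poly_Mapping.lookup (c G) m)"
proof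
  define h where "h F = (if x \<in> F then koszul_sign x F * div_var x (c (F - {x})) else 0)" for F
  show "h \<in> koszul_chains (sr_ideal UNIV) (Suc i) j"
    unfolding koszul_chains_iff
  proof (intro allI impI)
    fix F m assume nz: "Poly_Mapping.lookup (h F) m \<noteq> 0"
    then have x: "x \<in> F" by (auto simp: h_def split: if_splits)
    have "Poly_Mapping.lookup (div_var x (c (F - {x}))) m \<noteq> 0"
      using nz x koszul_sign_mult_cases[of x F "div_var x (c (F - {x}))"] by (auto simp: h_def)
    then have "card (F - {x}) = i" "int (mdeg (Poly_Mapping.single x 1 + m)) = j - int i"
      using c unfolding koszul_chains_iff lookup_div_var by blast+
    moreover have "card F = Suc (card (F - {x}))"
      using x by (simp add: card_Suc_Diff1 del: card_Diff_insert)
    ultimately show "card F = Suc i \<and> Poly_Mapping.keys m \<in> UNIV \<and> int (mdeg m) = j - int (Suc i)"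
      by (simp add: mdeg_add mdeg_single)
  qed
  fix G m
  show "Poly_Mapping.lookup (c G - koszul_d h G) m =
      (if x \<in> G \<or> x \<in> Poly_Mapping.keys m then 0 else Poly_Mapping.lookup (c G) m)"
  proof (cases "x \<in> G")
    case True
    define H where "H = G - {x}"
    have G: "G = insert x H" and H: "x \<notin> H" using True by (auto simp: H_def)
    have cpl: "- H = insert x (- G)" using G H by auto
    have 1: "koszul_sign x H * koszul_d c H =
        var x * c G + (\<Sum>k\<in>- G. koszul_sign x H * (koszul_sign k H * (var k * c (insert k H))))"
    proof -
      have "koszul_d c H = koszul_sign x H * (var x * c G) +
          (\<Sum>k\<in>- G. koszul_sign k H * (var k * c (insert k H)))"
        unfolding koszul_d_alt cpl by (subst sum.insert) (simp_all add: True G[symmetric])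
      moreover have "koszul_sign x H * (koszul_sign x H * q) = q" for q :: "('v, 'k) mpoly"
        by (simp add: mult.assoc[symmetric])
      ultimately show ?thesis
        by (simp only: distrib_left sum_distrib_left)
    qed
    \<comment> \<open>Dividing the cycle condition at \<open>H\<close> by \<open>x\<close> expresses
      \<open>c G\<close> through the remaining summands, which are those of
      \<open>koszul_d h G\<close> up to sign.\<close>
    have 2: "div_var x (koszul_sign x H * koszul_d c H) = c G + (\<Sum>k\<in>- G. koszul_sign x H * (koszul_sign k H * (var k * div_var x (c (insert k H)))))"
    proof -
      have "div_var x (var k * p) = var k * div_var x p" if "k \<in> - G" for k and p :: "('v, 'k) mpoly"
        using that True by (intro div_var_var_mult_neq) auto
      then show ?thesis
        unfolding 1 div_var_add div_var_sum div_var_koszul_sign_mult by simp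
    qed
    have "koszul_d h G =
        (\<Sum>k\<in>- G. - (koszul_sign x H * (koszul_sign k H * (var k * div_var x (c (insert k H))))))"
      unfolding koszul_d_alt
    proof (rule sum.cong[OF refl])
      fix k assume k: "k \<in> - G"
      then have eq: "insert k G - {x} = insert k H" using G H by auto
      have "h (insert k G) = koszul_sign x (insert k G) * div_var x (c (insert k H))"
        using True eq by (simp add: h_def)
      moreover have "koszul_sign k G * koszul_sign x (insert k G) =
          - (koszul_sign x H * (koszul_sign k H :: ('v, 'k) mpoly))"
      proof -
        have "insert k G = insert x (insert k H)" using G by auto
        moreover have "k \<notin> H" "k \<noteq> x" using k G by auto
        ultimately show ?thesis
          using H by (cases "x < k") (auto simp: G koszul_sign_insert mult.commute)
      qed
      then have "koszul_sign k G * (var k * (koszul_sign x (insert k G) * q)) =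
          - (koszul_sign x H * (koszul_sign k H * (var k * q)))" for q :: "('v, 'k) mpoly"
        by (metis (no_types) mult.assoc mult.left_commute mult_minus_left)
      ultimately show "koszul_sign k G * (var k * h (insert k G)) =
          - (koszul_sign x H * (koszul_sign k H * (var k * div_var x (c (insert k H)))))"
        by simp
    qed
    then have "c G - koszul_d h G = 0"
      using 2 by (simp add: cycle sum_negf)
    then show ?thesis using True by simp
  next
    case False
    have "koszul_d h G = (\<Sum>k\<in>{x}. koszul_sign k G * (var k * h (insert k G)))"
      unfolding koszul_d_alt
      by (rule sum.mono_neutral_right) (use False in \<open>auto simp: h_def\<close>)
    also have "\<dots> = var x * div_var x (c G)"
    proof -
      have "koszul_sign x G * (var x * (koszul_sign x G * q)) = var x * q" for q :: "('v, 'k) mpoly"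
        by (metis koszul_sign_sq mult.left_commute mult.assoc mult_1)
      then show ?thesis using False by (simp add: h_def)
    qed
    finally show ?thesis
      using False by (simp add: lookup_minus var_mult_div_var)
  qed
qed

text \<open>One variable at a time: the remainder is again a cycle, and each contraction only erases
  coefficients, so what was cleared stays cleared.\<close>

lemma koszul_contract_vars:
  fixes c :: "'v::{finite,linorder} set \<Rightarrow> ('v, 'k::comm_ring_1) mpoly"
  assumes "c \<in> koszul_chains (sr_ideal UNIV) i j" "koszul_d c = (\<lambda>_. 0)"
  shows "\<exists>h\<in>koszul_chains (sr_ideal UNIV) (Suc i) j. \<forall>G m.
    Poly_Mapping.lookup (c G - koszul_d h G) m \<noteq> 0 \<longrightarrow> (G \<union> Poly_Mapping.keys m) \<inter> X = {}"
  using finite[of X]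
proof (induction X rule: finite_induct)
  case empty
  have "(\<lambda>_. 0) \<in> koszul_chains (sr_ideal UNIV) (Suc i) j"
    by (simp add: koszul_chains_iff)
  then show ?case by auto
next
  case (insert x X)
  then obtain h where h: "h \<in> koszul_chains (sr_ideal UNIV) (Suc i) j"
    "\<And>G m. Poly_Mapping.lookup (c G - koszul_d h G) m \<noteq> 0 \<Longrightarrow> (G \<union> Poly_Mapping.keys m) \<inter> X = {}"
    by blast
  define c' where "c' G = c G - koszul_d h G" for G
  have "koszul_d h \<in> koszul_chains (sr_ideal UNIV) i j"
    using h(1) by (intro koszul_d_chains) (auto simp: up_closed_def)
  then have "c' \<in> koszul_chains (sr_ideal UNIV) i j"
    unfolding c'_def using assms(1) by (intro koszul_chains_diff)
  moreover have "koszul_d c' = (\<lambda>_. 0)"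
    unfolding c'_def koszul_d_diff assms(2) koszul_d_koszul_d by simp
  ultimately obtain h' where h': "h' \<in> koszul_chains (sr_ideal UNIV) (Suc i) j"
    and "\<And>G m. Poly_Mapping.lookup (c' G - koszul_d h' G) m =
      (if x \<in> G \<or> x \<in> Poly_Mapping.keys m then 0 else Poly_Mapping.lookup (c' G) m)"
    using koszul_contract_var[where x = x] by blast
  then have "(G \<union> Poly_Mapping.keys m) \<inter> insert x X = {}"
    if "Poly_Mapping.lookup (c' G - koszul_d h' G) m \<noteq> 0" for G m
    using that h(2)[of G m] by (auto simp: c'_def split: if_splits)
  moreover have "c G - koszul_d (\<lambda>F. h F + h' F) G = c' G - koszul_d h' G" for G
    by (simp add: c'_def koszul_d_add)
  ultimately show ?case
    using koszul_chains_add[OF h(1) h'] by (intro bexI[of _ "\<lambda>F. h F + h' F"]) auto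
qed

text \<open>Contracting all variables leaves at most a constant at the empty set, which has degree
  0. This handles links that become the whole ring.\<close>

lemma reg_le_UNIV:
  fixes K :: "'k::field itself"
  shows "reg_le K (UNIV :: 'v::{finite,linorder} set set) 0"
proof (rule reg_leI)
  fix i j and c :: "'v set \<Rightarrow> ('v, 'k) mpoly"
  assume r: "0 < j - int i" and c: "c \<in> koszul_chains (sr_ideal UNIV) i j"
    and cycle: "koszul_d c = (\<lambda>_. 0)"
  from koszul_contract_vars[OF c cycle, of UNIV] obtain h where
    h: "h \<in> koszul_chains (sr_ideal UNIV) (Suc i) j"
    "\<And>G m. Poly_Mapping.lookup (c G - koszul_d h G) m \<noteq> 0 \<Longrightarrow> G \<union> Poly_Mapping.keys m = {}"
    by auto
  have ch: "(\<lambda>G. c G - koszul_d h G) \<in> koszul_chains (sr_ideal UNIV) i j"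
    using h(1) by (intro koszul_chains_diff c koszul_d_chains) (auto simp: up_closed_def)
  have "Poly_Mapping.lookup (c G - koszul_d h G) m = 0" for G m
  proof (rule ccontr)
    assume nz: "Poly_Mapping.lookup (c G - koszul_d h G) m \<noteq> 0"
    then have "m = 0" using h(2) by auto
    moreover have "int (mdeg m) = j - int i"
      using ch nz unfolding koszul_chains_iff by blast
    ultimately show False using r by (simp add: mdeg_def)
  qed
  then have "c G - koszul_d h G = 0" for G
    by (intro poly_mapping_eqI) simp
  then have "c = koszul_d h" by (intro ext) simp
  then show "\<exists>b\<in>koszul_chains (sr_ideal UNIV) (Suc i) j. c = koszul_d b"
    using h(1) by blast
qed

lemma reg_le_empty:
  fixes K :: "'k::field itself"
  shows "reg_le K ({} :: 'v::{finite,linorder} set set) r"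
proof (rule reg_leI)
  fix i j and c :: "'v set \<Rightarrow> ('v, 'k) mpoly"
  assume "c \<in> koszul_chains (sr_ideal {}) i j"
  then have "Poly_Mapping.lookup (c F) m = 0" for F m
    unfolding koszul_chains_iff by blast
  then have "c = (\<lambda>_. 0)" by (intro ext poly_mapping_eqI) simp
  then have "c = koszul_d (\<lambda>_. 0)" by (auto simp: koszul_d_alt)
  moreover have "(\<lambda>_. 0) \<in> koszul_chains (sr_ideal {} :: ('v, 'k) mpoly set) (Suc i) j"
    by (simp add: koszul_chains_iff)
  ultimately show "\<exists>b\<in>koszul_chains (sr_ideal {}) (Suc i) j. c = koszul_d b" by blast
qed

text \<open>Variables in the ideal can be stripped off: the link at such a \<open>y\<close> is the
  whole ring with bound 0, and \<open>1 \<le> r\<close> leaves room for the one that the splitting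
  adds.\<close>

lemma reg_le_vars:
  assumes "up_closed U" "\<And>y. y \<in> N \<Longrightarrow> {y} \<in> U" "1 \<le> r"
    and "reg_le K {F. F - N \<in> U} r"
  shows "reg_le K U r"
  using finite[of N] assms
proof (induction N arbitrary: U rule: finite_induct)
  case empty
  then show ?case by simp
next
  case (insert y N)
  have "reg_le K (del y U) r"
  proof (rule insert.IH)
    show "{z} \<in> del y U" if "z \<in> N" for z
    proof -
      have "{z} - {y} = {z}" using that insert.hyps by auto
      then show ?thesis using that insert.prems by (simp add: del_def)
    qed
    have "F - N - {y} = F - insert y N" for F by auto
    then show "reg_le K {F. F - N \<in> del y U} r"
      using insert.prems by (simp add: del_def)
  qed (use insert.prems in \<open>auto intro: up_closed_del\<close>)
  moreover have "insert y F \<in> U" for F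
    using up_closedD[OF insert.prems(1), of "{y}" "insert y F"] insert.prems(2) by auto
  then have "link y U = UNIV" by (auto simp: link_def)
  then have "reg_le K (link y U) (r - 1)"
    using reg_le_mono[OF reg_le_UNIV, of "r - 1" K] insert.prems by simp
  ultimately show ?case
    using reg_le_link_del[OF insert.prems(1), of K y "r - 1"] by simp
qed

section \<open>Edge ideals and matchings\<close>

text \<open>\<open>edge_up E\<close> and \<open>pair_up E\<close> are the supports of the monomials
  of the edge ideal and of the second squarefree power.\<close>

definition edge_up :: "'v set set \<Rightarrow> 'v set set" where
  "edge_up E = {F. \<exists>e\<in>E. e \<subseteq> F}"

definition pair_up :: "'v set set \<Rightarrow> 'v set set" where
  "pair_up E = {F. \<exists>e1\<in>E. \<exists>e2\<in>E. e1 \<inter> e2 = {} \<and> e1 \<union> e2 \<subseteq> F}"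

text \<open>Vertex deletion. The vertex type stays fixed, so removed vertices merely become
  isolated.\<close>

definition avoid :: "'v set set \<Rightarrow> 'v set \<Rightarrow> 'v set set" where
  "avoid E X = {e \<in> E. e \<inter> X = {}}"

definition nbrs :: "'v set set \<Rightarrow> 'v \<Rightarrow> 'v set" where
  "nbrs E x = {y. {x, y} \<in> E}"

text \<open>A bound instead of the number itself passes to subgraphs without reasoning about
  \<open>Max\<close>.\<close>

definition nu_le :: "'v set set \<Rightarrow> nat \<Rightarrow> bool" where
  "nu_le E n \<longleftrightarrow> (\<forall>M. matching E M \<longrightarrow> card M \<le> n)"

lemma up_closed_edge_up: "up_closed (edge_up E)"
  unfolding up_closed_def edge_up_def by blast

lemma up_closed_pair_up: "up_closed (pair_up E)"
  unfolding up_closed_def pair_up_def by blast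

lemma simple_graph_subset: "simple_graph E \<Longrightarrow> E' \<subseteq> E \<Longrightarrow> simple_graph E'"
  unfolding simple_graph_def by blast

lemma simple_graph_edgeE:
  assumes "simple_graph E" "e \<in> E" "x \<in> e"
  obtains y where "e = {x, y}" "y \<noteq> x"
proof -
  obtain a b where "e = {a, b}" "a \<noteq> b"
    using assms unfolding simple_graph_def by (meson card_2_iff)
  then show ?thesis using assms(3) that[of a] that[of b] by auto
qed

lemma simple_graph_neq: "simple_graph E \<Longrightarrow> {x, y} \<in> E \<Longrightarrow> x \<noteq> y"
  unfolding simple_graph_def by force

lemma avoid_subset: "avoid E X \<subseteq> E"
  by (auto simp: avoid_def)

lemma avoid_psubset: "e \<in> E \<Longrightarrow> x \<in> e \<Longrightarrow> x \<in> X \<Longrightarrow> avoid E X \<subset> E"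
  by (auto simp: avoid_def)

lemma nu_le_subset: "nu_le E n \<Longrightarrow> E' \<subseteq> E \<Longrightarrow> nu_le E' n"
  unfolding nu_le_def matching_def by (meson subset_trans)

text \<open>Every matching that avoids \<open>e\<close> can be extended by \<open>e\<close>.\<close>

lemma nu_le_avoid_edge:
  fixes E :: "'v::finite set set"
  assumes "nu_le E n" "e \<in> E" "e \<noteq> {}"
  obtains n' where "n = Suc n'" "nu_le (avoid E e) n'"
proof -
  have *: "Suc (card M) \<le> n" if "matching (avoid E e) M" for M
  proof -
    have M: "M \<subseteq> E" "\<And>d. d \<in> M \<Longrightarrow> d \<inter> e = {}"
      "\<And>d d'. d \<in> M \<Longrightarrow> d' \<in> M \<Longrightarrow> d \<noteq> d' \<Longrightarrow> d \<inter> d' = {}"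
      using that by (auto simp: matching_def avoid_def)
    have "matching E (insert e M)"
      unfolding matching_def
    proof (intro conjI ballI impI)
      show "insert e M \<subseteq> E" using M(1) assms(2) by simp
      fix d d' assume "d \<in> insert e M" "d' \<in> insert e M" "d \<noteq> d'"
      then show "d \<inter> d' = {}" using M(2,3) by (metis Int_commute insertE)
    qed
    then have "card (insert e M) \<le> n"
      using assms(1) by (simp add: nu_le_def)
    moreover have "e \<notin> M" using M(2) assms(3) by auto
    ultimately show ?thesis by simp
  qed
  \<comment> \<open>The empty matching gives \<open>1 \<le> n\<close>, so \<open>n - 1\<close> is a
    true predecessor.\<close>
  have "matching (avoid E e) {}" by (simp add: matching_def)
  from *[OF this] have "n = Suc (n - 1)" by simp
  moreover have "nu_le (avoid E e) (n - 1)"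
    unfolding nu_le_def using * by force
  ultimately show ?thesis by (rule that)
qed

section \<open>Vertex deletion and the regularity of edge ideals\<close>

lemma del_edge_up: "del x (edge_up E) = edge_up (avoid E {x})"
  unfolding del_def edge_up_def avoid_def by blast

lemma del_pair_up: "del x (pair_up E) = pair_up (avoid E {x})"
  unfolding del_def pair_up_def avoid_def by blast

text \<open>The link at \<open>x\<close> is generated by the neighbours of \<open>x\<close>, as
  variables, and the edges of \<open>G - N[x]\<close>; \<open>reg_le_vars\<close> strips off the
  variables.\<close>

lemma reg_le_edge_up_vertex:
  assumes E: "simple_graph E" and r: "1 \<le> r"
    and del: "reg_le K (edge_up (avoid E {x})) (r + 1)"
    and link: "reg_le K (edge_up (avoid E (insert x (nbrs E x)))) r"
  shows "reg_le K (edge_up E) (r + 1)"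
proof (rule reg_le_link_del[where x = x])
  show "reg_le K (link x (edge_up E)) r"
  proof (rule reg_le_vars[where N = "nbrs E x"])
    show "{y} \<in> link x (edge_up E)" if "y \<in> nbrs E x" for y
      using that by (auto simp: link_def edge_up_def nbrs_def)
    have "insert x (F - nbrs E x) \<in> edge_up E \<longleftrightarrow> F \<in> edge_up (avoid E (insert x (nbrs E x)))" for F
    proof
      assume "insert x (F - nbrs E x) \<in> edge_up E"
      then obtain e where e: "e \<in> E" "e \<subseteq> insert x (F - nbrs E x)" by (auto simp: edge_up_def)
      \<comment> \<open>The other end of an edge at \<open>x\<close> is a neighbour, and the
        neighbours have been removed.\<close>
      have "x \<notin> e"
      proof
        assume "x \<in> e"
        then obtain z where "e = {x, z}" "z \<noteq> x" using E e(1) by (meson simple_graph_edgeE)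
        then show False using e by (auto simp: nbrs_def)
      qed
      then show "F \<in> edge_up (avoid E (insert x (nbrs E x)))"
        using e by (auto simp: edge_up_def avoid_def)
    qed (auto simp: edge_up_def avoid_def)
    then show "reg_le K {F. F - nbrs E x \<in> link x (edge_up E)} r"
      using link by (simp add: link_def)
  qed (use r in \<open>auto intro: up_closed_link up_closed_edge_up\<close>)
qed (use del in \<open>auto simp: del_edge_up up_closed_edge_up\<close>)

text \<open>Both pieces of the splitting have fewer edges, and the link also has a smaller matching
  bound, so \<open>n\<close> varies in the induction.\<close>

lemma reg_le_edge_up:
  assumes "simple_graph E" "nu_le E n"
  shows "reg_le K (edge_up E) (int n + 1)"
  using finite[of E] assms
proof (induction E arbitrary: n rule: finite_psubset_induct)
  case (psubset E)
  show ?case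
  proof (cases "E = {}")
    case True
    then show ?thesis by (simp add: edge_up_def reg_le_empty)
  next
    case False
    then obtain e x where "e \<in> E" "x \<in> e"
      using psubset.prems(1) unfolding simple_graph_def by fastforce
    then obtain y where e: "{x, y} \<in> E"
      using psubset.prems(1) by (metis simple_graph_edgeE)
    obtain n' where n': "n = Suc n'" "nu_le (avoid E {x, y}) n'"
      using nu_le_avoid_edge[OF psubset.prems(2) e] by blast
    have "avoid E (insert x (nbrs E x)) \<subseteq> avoid E {x, y}"
      using e by (auto simp: avoid_def nbrs_def)
    then have "reg_le K (edge_up (avoid E (insert x (nbrs E x)))) (int n' + 1)"
      using psubset.prems n'(2) e
      by (intro psubset.IH avoid_psubset[of "{x, y}" _ x])
        (auto intro: simple_graph_subset[OF _ avoid_subset] nu_le_subset)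
    moreover have "reg_le K (edge_up (avoid E {x})) (int n + 1)"
      using psubset.prems e
      by (intro psubset.IH avoid_psubset[of "{x, y}" _ x])
        (auto intro: simple_graph_subset[OF _ avoid_subset] nu_le_subset[OF _ avoid_subset])
    ultimately show ?thesis
      using reg_le_edge_up_vertex[OF psubset.prems(1), of "int n' + 1"] n'(1) by (simp add: add_ac)
  qed
qed

text \<open>The graph whose edge ideal is the colon of the second squarefree power by
  \<open>x y\<close>: an edge off \<open>x\<close> and \<open>y\<close> pairs with
  \<open>{x, y}\<close> itself, and \<open>{a, b}\<close> stems from the disjoint edges
  \<open>{x, a}\<close> and \<open>{y, b}\<close>.\<close>

definition cross :: "'v set set \<Rightarrow> 'v \<Rightarrow> 'v \<Rightarrow> 'v set set" where
  "cross E x y = avoid E {x, y} \<union>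
    {{a, b} | a b. {x, a} \<in> E \<and> {y, b} \<in> E \<and> a \<noteq> b \<and> a \<noteq> y \<and> b \<noteq> x}"

lemma simple_graph_cross: "simple_graph E \<Longrightarrow> simple_graph (cross E x y)"
  unfolding simple_graph_def cross_def avoid_def by auto

text \<open>Keeps the induction over cross graphs inside that family.\<close>

lemma avoid_cross:
  assumes "a \<noteq> x" "a \<noteq> y"
  shows "avoid (cross E x y) {a} = cross (avoid E {a}) x y"
  using assms unfolding cross_def avoid_def by fastforce

text \<open>Vertices \<open>a\<close> are deleted one by one. If no cross pair is left, the edge
  \<open>{x, y}\<close> saves one; otherwise the link at \<open>a\<close> loses the two matching
  edges \<open>{x, a}\<close> and \<open>{y, b}\<close>, and
  \<open>(n - 2) + 1 + 1 = n\<close>.\<close>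

lemma reg_le_edge_up_cross:
  assumes "simple_graph E" "nu_le E n" "{x, y} \<in> E"
  shows "reg_le K (edge_up (cross E x y)) (int n)"
  using finite[of E] assms
proof (induction E rule: finite_psubset_induct)
  case (psubset E)
  note E = psubset.prems(1)
  show ?case
  proof (cases "\<exists>a b. {x, a} \<in> E \<and> {y, b} \<in> E \<and> a \<noteq> b \<and> a \<noteq> y \<and> b \<noteq> x")
    case False
    then have "cross E x y = avoid E {x, y}" unfolding cross_def by blast
    moreover obtain n' where "n = Suc n'" "nu_le (avoid E {x, y}) n'"
      using nu_le_avoid_edge[OF psubset.prems(2,3)] by blast
    ultimately show ?thesis
      using reg_le_edge_up[of "avoid E {x, y}" n' K] simple_graph_subset[OF E avoid_subset]
      by (simp add: add_ac)
  next
    case True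
    then obtain a b where ab: "{x, a} \<in> E" "{y, b} \<in> E" "a \<noteq> b" "a \<noteq> y" "b \<noteq> x" by blast
    have neq: "a \<noteq> x" "x \<noteq> y" "b \<noteq> y"
      using simple_graph_neq[OF E] ab psubset.prems(3) by blast+
    obtain n1 where n1: "n = Suc n1" "nu_le (avoid E {x, a}) n1"
      using nu_le_avoid_edge[OF psubset.prems(2) ab(1)] by blast
    have "{y, b} \<in> avoid E {x, a}" using ab neq by (auto simp: avoid_def)
    then obtain n2 where n2: "n1 = Suc n2" "nu_le (avoid (avoid E {x, a}) {y, b}) n2"
      using nu_le_avoid_edge[OF n1(2)] by blast
    have "reg_le K (edge_up (cross (avoid E {a}) x y)) (int n)"
    proof (intro psubset.IH avoid_psubset[of "{x, a}" _ a])
      show "{x, y} \<in> avoid E {a}" using psubset.prems(3) ab neq by (auto simp: avoid_def)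
    qed (use psubset.prems ab in
        \<open>auto intro: simple_graph_subset[OF _ avoid_subset] nu_le_subset[OF _ avoid_subset]\<close>)
    then have del: "reg_le K (edge_up (avoid (cross E x y) {a})) (int n2 + 1 + 1)"
      using avoid_cross[OF neq(1) ab(4)] n1 n2 by (simp add: add_ac)
    have bN: "b' \<in> nbrs (cross E x y) a" if "{y, b'} \<in> E" "b' \<noteq> a" "b' \<noteq> x" for b'
      using that ab unfolding nbrs_def cross_def by blast
    let ?R = "avoid (cross E x y) (insert a (nbrs (cross E x y) a))"
    have sub: "?R \<subseteq> avoid (avoid E {x, a}) {y, b}"
    proof
      fix e assume "e \<in> ?R"
      then have e: "e \<in> cross E x y" "a \<notin> e" "\<And>z. z \<in> nbrs (cross E x y) a \<Longrightarrow> z \<notin> e"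
        by (auto simp: avoid_def)
      \<comment> \<open>A cross edge has an end \<open>b'\<close> that is \<open>a\<close> itself
        or, by \<open>bN\<close>, a neighbour of \<open>a\<close>; so none survives in the
        link.\<close>
      have "e \<in> avoid E {x, y}"
      proof (rule ccontr)
        assume "e \<notin> avoid E {x, y}"
        then obtain a' b' where "e = {a', b'}" "{y, b'} \<in> E" "b' \<noteq> x"
          using e(1) unfolding cross_def by blast
        then show False using e(2,3) bN[of b'] by auto
      qed
      moreover have "b \<notin> e" using e(3) bN[of b] ab by auto
      ultimately show "e \<in> avoid (avoid E {x, a}) {y, b}"
        using e(2) by (auto simp: avoid_def)
    qed
    then have "reg_le K (edge_up ?R) (int n2 + 1)"
      using n2(2) simple_graph_cross[OF E]
      by (intro reg_le_edge_up) (auto intro: simple_graph_subset[OF _ avoid_subset] nu_le_subset)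
    then have "reg_le K (edge_up (cross E x y)) (int n2 + 1 + 1)"
      by (intro reg_le_edge_up_vertex[OF simple_graph_cross[OF E] _ del]) auto
    then show ?thesis using n1 n2 by (simp add: add_ac)
  qed
qed

text \<open>Of two disjoint edges within \<open>insert x (insert y F)\<close>, either one avoids
  \<open>x\<close> and \<open>y\<close> and hence lies in \<open>F\<close>, or disjointness puts
  \<open>x\<close> in one and \<open>y\<close> in the other, which yields a cross edge.\<close>

lemma link_link_pair_up:
  assumes E: "simple_graph E" and xy: "{x, y} \<in> E"
  shows "link y (link x (pair_up E)) = edge_up (cross E x y)"
proof (intro set_eqI iffI)
  fix F assume "F \<in> edge_up (cross E x y)"
  then consider e where "e \<in> avoid E {x, y}" "e \<subseteq> F"
    | a b where "{x, a} \<in> E" "{y, b} \<in> E" "a \<noteq> b" "a \<noteq> y" "b \<noteq> x" "{a, b} \<subseteq> F"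
    unfolding edge_up_def cross_def by blast
  then show "F \<in> link y (link x (pair_up E))"
  proof cases
    case 1
    then have "e \<in> E" "e \<inter> {x, y} = {}" "e \<union> {x, y} \<subseteq> insert x (insert y F)"
      by (auto simp: avoid_def)
    then show ?thesis using xy unfolding link_def pair_up_def by blast
  next
    case 2
    then have "{x, a} \<inter> {y, b} = {}" "{x, a} \<union> {y, b} \<subseteq> insert x (insert y F)"
      using simple_graph_neq[OF E xy] by auto
    then show ?thesis using 2(1,2) unfolding link_def pair_up_def by blast
  qed
next
  fix F assume "F \<in> link y (link x (pair_up E))"
  then obtain e1 e2 where e: "e1 \<in> E" "e2 \<in> E" "e1 \<inter> e2 = {}" "e1 \<union> e2 \<subseteq> insert x (insert y F)"
    unfolding link_def pair_up_def by blast
  have avoiding: "F \<in> edge_up (cross E x y)"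
    if "d \<in> E" "d \<inter> {x, y} = {}" "d \<subseteq> insert x (insert y F)" for d
  proof -
    have "d \<subseteq> F" using that by auto
    then show ?thesis using that unfolding edge_up_def cross_def avoid_def by blast
  qed
  have crossing: "F \<in> edge_up (cross E x y)"
    if pq: "p \<in> E" "q \<in> E" "x \<in> p" "y \<in> q" "p \<inter> q = {}" "p \<union> q \<subseteq> insert x (insert y F)" for p q
  proof -
    obtain a where a: "p = {x, a}" "a \<noteq> x" using simple_graph_edgeE[OF E pq(1,3)] .
    obtain b where b: "q = {y, b}" "b \<noteq> y" using simple_graph_edgeE[OF E pq(2,4)] .
    have "a \<noteq> b" "a \<noteq> y" "b \<noteq> x" "{a, b} \<subseteq> F" using pq a b by auto
    moreover from this have "{a, b} \<in> cross E x y"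
      using pq(1,2) a b unfolding cross_def by blast
    ultimately show ?thesis unfolding edge_up_def by blast
  qed
  show "F \<in> edge_up (cross E x y)"
  proof (cases "e1 \<inter> {x, y} = {} \<or> e2 \<inter> {x, y} = {}")
    case True
    then show ?thesis using avoiding e by blast
  next
    case False
    then have "x \<in> e1 \<and> y \<in> e2 \<or> x \<in> e2 \<and> y \<in> e1" using e(3) by blast
    then show ?thesis using crossing e by blast
  qed
qed

text \<open>Peels off the neighbours \<open>y\<close> of \<open>x\<close>: the deletion is the same
  link for \<open>G - y\<close>, and the link at \<open>y\<close> is the edge ideal of a cross
  graph, with bound \<open>n\<close>.\<close>

lemma reg_le_link_pair_up:
  assumes "simple_graph E" "nu_le E n"
    and "reg_le K (pair_up (avoid E (insert x (nbrs E x)))) (int n + 1)"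
  shows "reg_le K (link x (pair_up E)) (int n + 1)"
  using finite[of E] assms
proof (induction E rule: finite_psubset_induct)
  case (psubset E)
  note E = psubset.prems(1)
  show ?case
  proof (cases "nbrs E x = {}")
    \<comment> \<open>Now \<open>x\<close> is isolated, and the link is the ideal of
      \<open>G - N[x]\<close>, covered by the third hypothesis.\<close>
    case True
    have notin: "x \<notin> e" if "e \<in> E" for e
      using True that E unfolding nbrs_def by (metis empty_iff mem_Collect_eq simple_graph_edgeE)
    then have "avoid E {x} = E" by (auto simp: avoid_def)
    moreover have "e \<subseteq> insert x F \<longleftrightarrow> e \<subseteq> F" if "e \<in> E" for e F
      using notin[OF that] by auto
    then have "link x (pair_up E) = pair_up E"
      unfolding link_def pair_up_def by simp
    ultimately show ?thesis using psubset.prems(3) True by simp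
  next
    case False
    then obtain y where y: "{x, y} \<in> E" by (auto simp: nbrs_def)
    have xy: "x \<noteq> y" using simple_graph_neq[OF E y] .
    have "nbrs (avoid E {y}) x = nbrs E x - {y}"
      using xy by (auto simp: nbrs_def avoid_def)
    \<comment> \<open>Since \<open>y\<close> lies in \<open>N[x]\<close>, the graph
      \<open>G - N[x]\<close> and with it the third hypothesis are unchanged by deleting
      \<open>y\<close>.\<close>
    then have "avoid (avoid E {y}) (insert x (nbrs (avoid E {y}) x)) = avoid E (insert x (nbrs E x))"
      using y by (auto simp: avoid_def nbrs_def)
    then have "reg_le K (link x (pair_up (avoid E {y}))) (int n + 1)"
      using psubset.prems y
      by (intro psubset.IH avoid_psubset[of "{x, y}" _ y])
        (auto intro: simple_graph_subset[OF _ avoid_subset] nu_le_subset[OF _ avoid_subset])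
    moreover have "del y (link x (pair_up E)) = link x (del y (pair_up E))"
    proof -
      have "insert x (F - {y}) = insert x F - {y}" for F using xy by auto
      then show ?thesis by (simp add: del_def link_def)
    qed
    ultimately have "reg_le K (del y (link x (pair_up E))) (int n + 1)"
      by (simp add: del_pair_up)
    moreover have "reg_le K (link y (link x (pair_up E))) (int n)"
      unfolding link_link_pair_up[OF E y] using psubset.prems(2) y by (intro reg_le_edge_up_cross[OF E])
    ultimately show ?thesis
      by (rule reg_le_link_del[OF up_closed_link[OF up_closed_pair_up], rotated])
  qed
qed

text \<open>The induction hypothesis for \<open>G - N[x]\<close> is taken at \<open>n - 1\<close>;
  its bound \<open>(n - 1) + 2\<close> is the \<open>n + 1\<close> that
  \<open>reg_le_link_pair_up\<close> asks for.\<close>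

lemma reg_le_pair_up:
  assumes "simple_graph E" "nu_le E n"
  shows "reg_le K (pair_up E) (int n + 2)"
  using finite[of E] assms
proof (induction E arbitrary: n rule: finite_psubset_induct)
  case (psubset E)
  show ?case
  proof (cases "E = {}")
    case True
    then show ?thesis by (simp add: pair_up_def reg_le_empty)
  next
    case False
    then obtain e x where "e \<in> E" "x \<in> e"
      using psubset.prems(1) unfolding simple_graph_def by fastforce
    then obtain y where e: "{x, y} \<in> E"
      using psubset.prems(1) by (metis simple_graph_edgeE)
    obtain n' where n': "n = Suc n'" "nu_le (avoid E {x, y}) n'"
      using nu_le_avoid_edge[OF psubset.prems(2) e] by blast
    have "avoid E (insert x (nbrs E x)) \<subseteq> avoid E {x, y}"
      using e by (auto simp: avoid_def nbrs_def)
    then have "reg_le K (pair_up (avoid E (insert x (nbrs E x)))) (int n' + 2)"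
      using psubset.prems n'(2) e
      by (intro psubset.IH avoid_psubset[of "{x, y}" _ x])
        (auto intro: simple_graph_subset[OF _ avoid_subset] nu_le_subset)
    then have "reg_le K (link x (pair_up E)) (int n + 1)"
      using n'(1) by (intro reg_le_link_pair_up psubset.prems) (simp add: add_ac)
    moreover have "reg_le K (del x (pair_up E)) (int n + 1 + 1)"
      unfolding del_pair_up using psubset.prems e psubset.IH[of "avoid E {x}" n]
      by (simp add: add_ac avoid_psubset[of "{x, y}" _ x] simple_graph_subset[OF _ avoid_subset]
          nu_le_subset[OF _ avoid_subset])
    ultimately have "reg_le K (pair_up E) (int n + 1 + 1)"
      by (rule reg_le_link_del[OF up_closed_pair_up])
    then show ?thesis by (simp add: add_ac)
  qed
qed

section \<open>The second squarefree power\<close>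

lemma gen_ideal_monomials:
  "gen_ideal ((\<lambda>s. Poly_Mapping.single s (1::'k::comm_ring_1)) ` S) =
    {p. \<forall>m\<in>Poly_Mapping.keys p. \<exists>s\<in>S. \<exists>t. m = t + (s :: 'v \<Rightarrow>\<^sub>0 nat)}"
proof (intro set_eqI iffI CollectI ballI)
  fix p :: "('v, 'k) mpoly" and m
  assume "p \<in> gen_ideal ((\<lambda>s. Poly_Mapping.single s 1) ` S)" and m: "m \<in> Poly_Mapping.keys p"
  then obtain T r where T: "T \<subseteq> (\<lambda>s. Poly_Mapping.single s (1::'k)) ` S" "p = (\<Sum>a\<in>T. r a * a)"
    unfolding gen_ideal_def by blast
  obtain a where a: "a \<in> T" "m \<in> Poly_Mapping.keys (r a * a)"
    using m keys_sum[of "\<lambda>a. r a * a" T] unfolding T(2) by auto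
  then obtain s where "s \<in> S" "a = Poly_Mapping.single s 1" using T by auto
  then show "\<exists>s\<in>S. \<exists>t. m = t + s"
    using a(2) keys_mult[of "r a" a] by fastforce
next
  fix p :: "('v, 'k) mpoly"
  assume "p \<in> {p. \<forall>m\<in>Poly_Mapping.keys p. \<exists>s\<in>S. \<exists>t. m = t + s}"
  then have "\<forall>m\<in>Poly_Mapping.keys p. \<exists>st. fst st \<in> S \<and> m = snd st + fst st" by force
  then obtain st where st: "\<And>m. m \<in> Poly_Mapping.keys p \<Longrightarrow> fst (st m) \<in> S \<and> m = snd (st m) + fst (st m)"
    by metis
  define g where "g m = Poly_Mapping.single (fst (st m)) (1::'k)" for m
  define q where "q m = Poly_Mapping.single (snd (st m)) (Poly_Mapping.lookup p m)" for m
  have "p = (\<Sum>m\<in>Poly_Mapping.keys p. Poly_Mapping.single m (Poly_Mapping.lookup p m))"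
    by (simp add: poly_mapping_sum_monomials)
  also have "\<dots> = (\<Sum>m\<in>Poly_Mapping.keys p. q m * g m)"
    by (rule sum.cong[OF refl]) (simp add: q_def g_def mult_single st[THEN conjunct2, symmetric])
  \<comment> \<open>Several monomials may have chosen the same generator, while
    \<open>gen_ideal\<close> allows one coefficient per generator; hence the grouping.\<close>
  also have "\<dots> = (\<Sum>a\<in>g ` Poly_Mapping.keys p. \<Sum>m\<in>{m \<in> Poly_Mapping.keys p. g m = a}. q m * g m)"
    by (rule sum.image_gen) simp
  also have "\<dots> = (\<Sum>a\<in>g ` Poly_Mapping.keys p. (\<Sum>m\<in>{m \<in> Poly_Mapping.keys p. g m = a}. q m) * a)"
    by (rule sum.cong[OF refl]) (simp add: sum_distrib_right)
  finally have "p = \<dots>" .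
  moreover have "g ` Poly_Mapping.keys p \<subseteq> (\<lambda>s. Poly_Mapping.single s 1) ` S"
    using st by (auto simp: g_def)
  ultimately show "p \<in> gen_ideal ((\<lambda>s. Poly_Mapping.single s 1) ` S)"
    unfolding gen_ideal_def mem_Collect_eq by (meson finite_imageI finite_keys)
qed

definition set_mon :: "'v::finite set \<Rightarrow> ('v \<Rightarrow>\<^sub>0 nat)" where
  "set_mon e = (\<Sum>v\<in>e. Poly_Mapping.single v 1)"

lemma lookup_set_mon: "Poly_Mapping.lookup (set_mon e) v = (if v \<in> e then 1 else 0)"
  by (simp add: set_mon_def lookup_sum lookup_single when_def)

lemma edge_mon_eq_single: "edge_mon e = Poly_Mapping.single (set_mon e) 1"
proof -
  have "finite e" by simp
  then show ?thesis
    unfolding edge_mon_def set_mon_def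
    by (induction e rule: finite_induct) (simp_all add: var_def mult_single)
qed

lemma set_mon_divides_iff:
  "(\<exists>t. m = t + set_mon e) \<longleftrightarrow> e \<subseteq> Poly_Mapping.keys m"
proof
  assume "e \<subseteq> Poly_Mapping.keys m"
  then have "m = (m - set_mon e) + set_mon e"
    by (intro poly_mapping_eqI) (auto simp: lookup_add lookup_minus lookup_set_mon in_keys_iff)
  then show "\<exists>t. m = t + set_mon e" ..
qed (auto simp: in_keys_iff lookup_add lookup_set_mon)

text \<open>Disjointness makes the product of two edge monomials the squarefree monomial of their
  union, and divisibility by it depends on supports alone.\<close>

lemma sqfree_power2_eq_sr_ideal:
  fixes E :: "'v::finite set set"
  shows "(sqfree_power2 E :: ('v, 'k::comm_ring_1) mpoly set) = sr_ideal (pair_up E)"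
proof -
  define P where "P = {e1 \<union> e2 | e1 e2. e1 \<in> E \<and> e2 \<in> E \<and> e1 \<inter> e2 = {}}"
  have "edge_mon e1 * edge_mon e2 = (edge_mon (e1 \<union> e2) :: ('v, 'k) mpoly)" if "e1 \<inter> e2 = {}" for e1 e2
    unfolding edge_mon_def using that by (subst prod.union_disjoint) auto
  then have "{edge_mon e1 * edge_mon e2 :: ('v, 'k) mpoly | e1 e2. e1 \<in> E \<and> e2 \<in> E \<and> e1 \<inter> e2 = {}} =
      edge_mon ` P"
    unfolding P_def by (auto simp: image_iff) metis+
  also have "\<dots> = (\<lambda>s. Poly_Mapping.single s 1) ` set_mon ` P"
    by (simp add: image_image edge_mon_eq_single)
  finally have "(sqfree_power2 E :: ('v, 'k) mpoly set) =
      {p. \<forall>m\<in>Poly_Mapping.keys p. \<exists>e\<in>P. \<exists>t. m = t + set_mon e}"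
    unfolding sqfree_power2_def by (simp add: gen_ideal_monomials)
  moreover have "(\<exists>e\<in>P. e \<subseteq> F) \<longleftrightarrow> F \<in> pair_up E" for F
    unfolding P_def pair_up_def by blast
  ultimately show ?thesis
    by (simp add: set_mon_divides_iff sr_ideal_def)
qed

text \<open>For \<open>j < i\<close> coefficients would have negative degree. This bounds from below
  the set whose \<open>Max\<close> defines \<open>reg\<close>.\<close>

lemma tor_nonzero_imp_le:
  fixes U :: "'v::{finite,linorder} set set"
  assumes "tor_nonzero (sr_ideal U :: ('v, 'k::field) mpoly set) i j"
  shows "int i \<le> j"
proof (rule ccontr)
  assume neg: "\<not> int i \<le> j"
  have "c = koszul_d (\<lambda>_. 0)" if "c \<in> koszul_chains (sr_ideal U :: ('v, 'k) mpoly set) i j" for c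
  proof (intro ext poly_mapping_eqI)
    fix F m
    show "Poly_Mapping.lookup (c F) m = Poly_Mapping.lookup (koszul_d (\<lambda>_. 0) F) m"
      using that neg unfolding koszul_chains_iff by (force simp: koszul_d_alt)
  qed
  moreover have "(\<lambda>_. 0) \<in> koszul_chains (sr_ideal U :: ('v, 'k) mpoly set) (Suc i) j"
    by (simp add: koszul_chains_iff)
  ultimately show False
    using assms unfolding tor_nonzero_def by blast
qed

text \<open>A monomial of least degree in a nonzero ideal is a minimal generator.\<close>

lemma ex_tor_nonzero:
  fixes U :: "'v::{finite,linorder} set set"
  assumes "(sr_ideal U :: ('v, 'k::field) mpoly set) \<noteq> {0}"
  shows "\<exists>j. tor_nonzero (sr_ideal U :: ('v, 'k) mpoly set) 0 j"
proof -
  obtain p :: "('v, 'k) mpoly" where p: "p \<in> sr_ideal U" "p \<noteq> 0"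
    using assms sr_ideal_0 by blast
  then obtain m0 where "m0 \<in> Poly_Mapping.keys p" using keys_eq_empty[of p] by blast
  then have "Poly_Mapping.keys m0 \<in> U" using p by (simp add: sr_ideal_def)
  then obtain m where m: "Poly_Mapping.keys m \<in> U"
    and least: "\<And>m'. Poly_Mapping.keys m' \<in> U \<Longrightarrow> mdeg m \<le> mdeg m'"
    using ex_has_least_nat[of "\<lambda>m. Poly_Mapping.keys m \<in> U" m0 mdeg] by blast
  define c :: "'v set \<Rightarrow> ('v, 'k) mpoly"
    where "c F = (if F = {} then Poly_Mapping.single m 1 else 0)" for F
  have c: "c \<in> koszul_chains (sr_ideal U) 0 (int (mdeg m))"
    using m by (auto simp: koszul_chains_iff c_def lookup_single when_def)
  have "c \<notin> koszul_d ` koszul_chains (sr_ideal U) (Suc 0) (int (mdeg m))"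
  proof
    assume "c \<in> koszul_d ` koszul_chains (sr_ideal U) (Suc 0) (int (mdeg m))"
    then obtain b where b: "b \<in> koszul_chains (sr_ideal U) (Suc 0) (int (mdeg m))" "c = koszul_d b"
      by blast
    \<comment> \<open>Coefficients of a 1-chain of this internal degree have degree one less than
      the least possible.\<close>
    have "Poly_Mapping.lookup (b F) m' = 0" for F m'
      using b(1) least[of m'] unfolding koszul_chains_iff by force
    then have "b F = 0" for F by (intro poly_mapping_eqI) simp
    then have "c {} = 0" by (simp add: b(2) koszul_d_alt)
    then show False by (auto simp: c_def dest: arg_cong[where f = "\<lambda>p. Poly_Mapping.lookup p m"])
  qed
  then have "tor_nonzero (sr_ideal U :: ('v, 'k) mpoly set) 0 (int (mdeg m))"
    unfolding tor_nonzero_def using c koszul_d_chains_0[OF c] by blast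
  then show ?thesis ..
qed

text \<open>The \<open>Max\<close> is meaningful because its set lies in \<open>{0..r}\<close> and a
  minimal generator makes it nonempty; \<open>1 \<le> r\<close> covers the convention for the zero
  ideal.\<close>

lemma reg_sr_ideal_le:
  fixes U :: "'v::{finite,linorder} set set"
  assumes "reg_le TYPE('k::field) U r" "1 \<le> r"
  shows "reg (sr_ideal U :: ('v, 'k) mpoly set) \<le> r"
proof (cases "(sr_ideal U :: ('v, 'k) mpoly set) = {0}")
  case True
  then show ?thesis using assms by (simp add: reg_def)
next
  case False
  let ?X = "{j - int i | i j. tor_nonzero (sr_ideal U :: ('v, 'k) mpoly set) i j}"
  have le: "?X \<subseteq> {0..r}"
    using assms(1) tor_nonzero_imp_le unfolding reg_le_def by fastforce
  have "?X \<noteq> {}"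
    using ex_tor_nonzero[OF False] by blast
  then have "Max ?X \<in> ?X"
    by (intro Max_in finite_subset[OF le]) auto
  from subsetD[OF le this] have "Max ?X \<le> r" by simp
  then show ?thesis using False by (simp add: reg_def)
qed

lemma nu_le_matching_number: "nu_le (E :: 'v::finite set set) (matching_number E)"
  unfolding nu_le_def matching_number_def by (auto intro: Max_ge)

theorem theorem2p11:
  fixes E :: "('v::{finite,linorder}) set set"
  assumes "simple_graph E"
  shows "reg (sqfree_power2 E :: ('v, 'k::field) mpoly set) \<le> 2 + int (matching_number E)"
  unfolding sqfree_power2_eq_sr_ideal
  using reg_le_pair_up[OF assms nu_le_matching_number, of "TYPE('k)"]
  by (intro reg_sr_ideal_le) (simp_all add: add_ac)

end
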